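(* Let $A,B,C,D$ be four distinct points on a circle with center $O$ such that none of the triangles $ABC$, $ABD$, $ACD$, $BCD$ is equilateral, and let $H_A,H_B,H_C,H_D$ be the orthocenters of $\triangle BCD$, $\triangle ACD$, $\triangle ABD$, $\triangle ABC$, respectively. Let $P_A,P_B,P_C,P_D$ be points on the Euler lines $OH_A,OH_B,OH_C,OH_D$, respectively. Then $$\frac{P_AH_A}{P_AO}=\frac{P_BH_B}{P_BO}=\frac{P_CH_C}{P_CO}=\frac{P_DH_D}{P_DO}$$ if and only if $P_A,P_B,P_C,P_D$ correspond to the same triangle center with constant Shinagawa coefficients in their respective triangles, i.e. if and only if there are real constants $(u,v)\neq(0,0)$ such that $P_A,P_B,P_C,P_D$ are the triangle centers with constant Shinagawa coefficients $(u,v)$ of $\triangle BCD$, $\triangle ACD$, $\triangle ABD$, $\triangle ABC$, respectively.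
   Context: We work in the real projective plane obtained from the Euclidean plane by adding the line at infinity. The Euler line of a non-equilateral triangle is the line through its circumcenter and orthocenter. The ratios $\frac{P_XH_X}{P_XO}$ are signed ratios of collinear segments with values in $\mathbb{R}\cup\{\infty\}$: the value is $\infty$ when $P_X=O$ and $1$ when $P_X$ is the point at infinity of the line $OH_X$. Shinagawa coefficients: for a triangle with vertices $V_1,V_2,V_3$ and opposite side lengths $a,b,c$, put $S=2\cdot\mathrm{Area}(\triangle V_1V_2V_3)$ and $$S_A=\tfrac12(b^2+c^2-a^2),\quad S_B=\tfrac12(c^2+a^2-b^2),\quad S_C=\tfrac12(a^2+b^2-c^2).$$ A triangle center on the Euler line with homogeneous barycentric coordinates $(f(a,b,c):f(b,c,a):f(c,a,b))$ has Shinagawa coefficients $(G(a,b,c),H(a,b,c))$ if $f(a,b,c)=G(a,b,c)\,S^2+H(a,b,c)\,S_BS_C$, together with the analogous cyclic conditions. It has constant Shinagawa coefficients $(u,v)$ if $G=u$ and $H=v$ are constants (not both zero), so that the center is the point $$(uS^2+vS_BS_C:\ uS^2+vS_CS_A:\ uS^2+vS_AS_B)$$ in barycentric coordinates relative to $V_1,V_2,V_3$. The pair $(u,v)$ is homogeneous: only the ratio $u:v$ matters. *)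

theory Defs
  imports "HOL-Analysis.Analysis"
begin

typedef direction = "{L :: (real^2) set. subspace L \<and> dim L = 1}"
  morphisms direction_space Abs_direction
proof
  show "span {axis 1 1 :: real^2} \<in> {L. subspace L \<and> dim L = 1}"
    by (simp add: dim_span axis_eq_0_iff)
qed

text \<open>The real projective plane: the Euclidean plane together with one point at infinity
  for each class of parallel lines, i.e. for each one-dimensional space of direction vectors.\<close>

datatype proj_point = Finite "real^2" | At_Infinity direction

text \<open>Only meant for \<open>X \<noteq> Y\<close>.\<close>

definition proj_line :: "real^2 \<Rightarrow> real^2 \<Rightarrow> proj_point set" where
  "proj_line X Y =
     Finite ` (affine hull {X, Y}) \<union> {At_Infinity d |d. direction_space d = span {Y - X}}"

definition equilateral :: "real^2 \<Rightarrow> real^2 \<Rightarrow> real^2 \<Rightarrow> bool" where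
  "equilateral V1 V2 V3 \<longleftrightarrow> dist V1 V2 = dist V2 V3 \<and> dist V2 V3 = dist V3 V1"

definition altitude :: "real^2 \<Rightarrow> real^2 \<Rightarrow> real^2 \<Rightarrow> (real^2) set" where
  "altitude V W1 W2 = {X. (X - V) \<bullet> (W1 - W2) = 0}"

definition is_orthocenter :: "real^2 \<Rightarrow> real^2 \<Rightarrow> real^2 \<Rightarrow> real^2 \<Rightarrow> bool" where
  "is_orthocenter H V1 V2 V3 \<longleftrightarrow>
     H \<in> altitude V1 V2 V3 \<inter> altitude V2 V3 V1 \<inter> altitude V3 V1 V2"

datatype ratio = Real_Ratio real | Infinite_Ratio

text \<open>The signed ratio \<open>PH / PO\<close>; only meant for \<open>P\<close> on the projective line through two
  distinct points \<open>O\<close> and \<open>H\<close> (the centre \<open>O\<close> is called \<open>Q\<close> here).\<close>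

fun signed_ratio :: "proj_point \<Rightarrow> real^2 \<Rightarrow> real^2 \<Rightarrow> ratio" where
  "signed_ratio (Finite P) H Q =
     (if P = Q then Infinite_Ratio else Real_Ratio (THE r. H - P = r *\<^sub>R (Q - P)))"
| "signed_ratio (At_Infinity d) H Q = Real_Ratio 1"

text \<open>\<open>P\<close> has homogeneous barycentric coordinates \<open>(x : y : z)\<close> relative to a
  nondegenerate triangle. Coordinates with sum zero, not all zero, describe the point at
  infinity in the direction of \<open>x V1 + y V2 + z V3\<close>; the triple \<open>(0, 0, 0)\<close> describes no point.\<close>

fun has_barycentric ::
    "proj_point \<Rightarrow> real^2 \<Rightarrow> real^2 \<Rightarrow> real^2 \<Rightarrow> real \<Rightarrow> real \<Rightarrow> real \<Rightarrow> bool" where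
  "has_barycentric (Finite P) V1 V2 V3 x y z \<longleftrightarrow>
     x + y + z \<noteq> 0 \<and> P = (1 / (x + y + z)) *\<^sub>R (x *\<^sub>R V1 + y *\<^sub>R V2 + z *\<^sub>R V3)"
| "has_barycentric (At_Infinity d) V1 V2 V3 x y z \<longleftrightarrow>
     x + y + z = 0 \<and> (x, y, z) \<noteq> (0, 0, 0) \<and>
     direction_space d = span {x *\<^sub>R V1 + y *\<^sub>R V2 + z *\<^sub>R V3}"

text \<open>\<open>P\<close> is the center \<open>(f(a,b,c) : f(b,c,a) : f(c,a,b))\<close> of the triangle, where
  \<open>a, b, c\<close> are the side lengths opposite \<open>V1, V2, V3\<close>.\<close>

definition is_center_of ::
    "(real \<Rightarrow> real \<Rightarrow> real \<Rightarrow> real) \<Rightarrow> proj_point \<Rightarrow> real^2 \<Rightarrow> real^2 \<Rightarrow> real^2 \<Rightarrow> bool" where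
  "is_center_of f P V1 V2 V3 \<longleftrightarrow>
     (let a = dist V2 V3; b = dist V3 V1; c = dist V1 V2
      in has_barycentric P V1 V2 V3 (f a b c) (f b c a) (f c a b))"

definition conway_S :: "real^2 \<Rightarrow> real^2 \<Rightarrow> real^2 \<Rightarrow> real" where
  "conway_S V1 V2 V3 = 2 * measure lebesgue (convex hull {V1, V2, V3})"

text \<open>\<open>S\<^sub>A\<close> for side lengths \<open>a, b, c\<close>; \<open>S\<^sub>B\<close> and \<open>S\<^sub>C\<close> are obtained by cyclic shifts.\<close>

definition conway_SA :: "real \<Rightarrow> real \<Rightarrow> real \<Rightarrow> real" where
  "conway_SA a b c = (b\<^sup>2 + c\<^sup>2 - a\<^sup>2) / 2"

definition has_shinagawa_coefficients ::
    "(real \<Rightarrow> real \<Rightarrow> real \<Rightarrow> real) \<Rightarrow> (real \<Rightarrow> real \<Rightarrow> real \<Rightarrow> real) \<Rightarrow>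
     (real \<Rightarrow> real \<Rightarrow> real \<Rightarrow> real) \<Rightarrow> bool" where
  "has_shinagawa_coefficients f G H \<longleftrightarrow>
     (\<forall>V1 V2 V3. \<not> collinear {V1, V2, V3} \<longrightarrow>
       (let a = dist V2 V3; b = dist V3 V1; c = dist V1 V2; S = conway_S V1 V2 V3;
            S\<^sub>A = conway_SA a b c; S\<^sub>B = conway_SA b c a; S\<^sub>C = conway_SA c a b
        in f a b c = G a b c * S\<^sup>2 + H a b c * (S\<^sub>B * S\<^sub>C) \<and>
           f b c a = G b c a * S\<^sup>2 + H b c a * (S\<^sub>C * S\<^sub>A) \<and>
           f c a b = G c a b * S\<^sup>2 + H c a b * (S\<^sub>A * S\<^sub>B)))"

definition has_constant_shinagawa_coefficients ::
    "(real \<Rightarrow> real \<Rightarrow> real \<Rightarrow> real) \<Rightarrow> real \<Rightarrow> real \<Rightarrow> bool" where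
  "has_constant_shinagawa_coefficients f u v \<longleftrightarrow>
     (u, v) \<noteq> (0, 0) \<and> has_shinagawa_coefficients f (\<lambda>a b c. u) (\<lambda>a b c. v)"

end

theory Submission
  imports Defs
begin

text \<open>With the circumcenter \<open>Q\<close> as origin, the center with constant Shinagawa coefficients
  \<open>(u, v)\<close> is \<open>(u + v) / (3 u + v)\<close> times the orthocenter: the coordinates \<open>(S\<^sub>B S\<^sub>C : S\<^sub>C S\<^sub>A : S\<^sub>A S\<^sub>B)\<close> of the
  orthocenter \<open>H\<close> sum to \<open>S\<^sup>2\<close>, and the vertices sum to \<open>H\<close>. So the ratio \<open>PH / PQ\<close> equals
  \<open>-2 u / (u + v)\<close>, which depends on \<open>u : v\<close> only and runs bijectively through the projective
  line.\<close>

section \<open>Gram determinants and collinearity in the plane\<close>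

lemma gram_eq_square:
  fixes e g :: "real^2"
  shows "(e \<bullet> e) * (g \<bullet> g) - (e \<bullet> g)\<^sup>2 = (e$1 * g$2 - e$2 * g$1)\<^sup>2"
  by (simp add: inner_vec_def sum_2 power2_eq_square algebra_simps)

text \<open>Cramer's rule: a nonzero Gram determinant makes \<open>e\<close>, \<open>g\<close> a
  basis of the plane. Vector identities about orthocenters can thus be checked by inner products
  with two sides.\<close>

lemma orthogonal_to_basis_eq_0:
  fixes e g x :: "real^2"
  assumes "(e \<bullet> e) * (g \<bullet> g) - (e \<bullet> g)\<^sup>2 \<noteq> 0" "x \<bullet> e = 0" "x \<bullet> g = 0"
  shows "x = 0"
proof -
  have c: "e$1 * g$2 - e$2 * g$1 \<noteq> 0"
    using assms(1) by (simp add: gram_eq_square)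
  have 1: "x$1 * e$1 + x$2 * e$2 = 0" and 2: "x$1 * g$1 + x$2 * g$2 = 0"
    using assms(2,3) by (simp_all add: inner_vec_def sum_2)
  have "x$1 * (e$1 * g$2 - e$2 * g$1) = 0" "x$2 * (e$1 * g$2 - e$2 * g$1) = 0"
    using 1 2 by algebra+
  with c show ?thesis by (simp add: vec_eq_iff forall_2)
qed

text \<open>This is the equality case of the Cauchy-Schwarz inequality for the two sides leaving
  \<open>V1\<close>.\<close>

lemma gram_nonzero_iff:
  fixes V1 V2 V3 :: "'a::euclidean_space"
  shows "((V2 - V1) \<bullet> (V2 - V1)) * ((V3 - V1) \<bullet> (V3 - V1)) - ((V2 - V1) \<bullet> (V3 - V1))\<^sup>2 \<noteq> 0 \<longleftrightarrow>
     \<not> collinear {V1, V2, V3}"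
proof -
  define e g where "e = V2 - V1" and "g = V3 - V1"
  have "collinear {V1, V2, V3} \<longleftrightarrow> collinear {V2, V1, V3}"
    by (simp add: insert_commute)
  also have "\<dots> \<longleftrightarrow> collinear {0, e, g}"
    unfolding e_def g_def by (subst collinear_3) auto
  also have "\<dots> \<longleftrightarrow> \<bar>e \<bullet> g\<bar> = norm e * norm g"
    by (simp add: norm_cauchy_schwarz_equal)
  also have "\<dots> \<longleftrightarrow> (e \<bullet> g)\<^sup>2 = (norm e * norm g)\<^sup>2"
    by (metis abs_mult abs_norm_cancel power2_eq_iff_nonneg abs_ge_zero power2_abs)
  also have "\<dots> \<longleftrightarrow> (e \<bullet> e) * (g \<bullet> g) - (e \<bullet> g)\<^sup>2 = 0"
    by (auto simp: power_mult_distrib power2_norm_eq_inner)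
  finally show ?thesis by (simp add: e_def g_def)
qed

text \<open>A line meets a sphere at most twice: on the line through \<open>V1\<close> and
  \<open>V3\<close>, the condition of lying on the sphere is quadratic in the parameter
  \<open>u\<close>, with roots 0 and 1.\<close>

lemma not_collinear_sphere:
  fixes V1 V2 V3 :: "'a::euclidean_space"
  assumes "distinct [V1, V2, V3]" "{V1, V2, V3} \<subseteq> sphere Q r"
  shows "\<not> collinear {V1, V2, V3}"
proof
  assume "collinear {V1, V2, V3}"
  then obtain u where u: "V2 = u *\<^sub>R V1 + (1 - u) *\<^sub>R V3"
    using assms(1) by (auto simp: collinear_3_expand)
  have sq: "(V1 - Q) \<bullet> (V1 - Q) = r\<^sup>2" "(V2 - Q) \<bullet> (V2 - Q) = r\<^sup>2" "(V3 - Q) \<bullet> (V3 - Q) = r\<^sup>2"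
    using assms(2) by (auto simp: dist_norm norm_minus_commute dot_square_norm)
  have V2: "V2 - Q = u *\<^sub>R (V1 - Q) + (1 - u) *\<^sub>R (V3 - Q)"
    by (simp add: u algebra_simps)
  define p where "p = V1 - Q"
  define q where "q = V3 - Q"
  have pq: "p \<bullet> p = r\<^sup>2" "q \<bullet> q = r\<^sup>2"
    using sq by (simp_all add: p_def q_def)
  have "r\<^sup>2 = u * u * (p \<bullet> p) + 2 * u * (1 - u) * (p \<bullet> q) + (1 - u) * (1 - u) * (q \<bullet> q)"
    unfolding sq(2)[symmetric] V2 p_def[symmetric] q_def[symmetric]
    by (simp add: inner_add_left inner_add_right inner_commute[of q p] algebra_simps)
  hence "u * (1 - u) * (p \<bullet> p - 2 * (p \<bullet> q) + q \<bullet> q) = 0"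
    using pq by algebra
  moreover have "p \<bullet> p - 2 * (p \<bullet> q) + q \<bullet> q = (p - q) \<bullet> (p - q)"
    by (simp add: inner_diff_left inner_diff_right inner_commute)
  ultimately have "u = 0 \<or> u = 1 \<or> p = q" by auto
  thus False
    using u assms(1) by (auto simp: p_def q_def)
qed

section \<open>Conway's notation in terms of inner products\<close>

text \<open>The law of cosines. It turns expressions in side lengths into vector algebra.\<close>

lemma conway_SA_inner:
  fixes V1 V2 V3 :: "real^2"
  shows "conway_SA (dist V2 V3) (dist V3 V1) (dist V1 V2) = (V2 - V1) \<bullet> (V3 - V1)"
proof -
  have "(dist V2 V3)\<^sup>2 = ((V2 - V1) - (V3 - V1)) \<bullet> ((V2 - V1) - (V3 - V1))"
       "(dist V3 V1)\<^sup>2 = (V3 - V1) \<bullet> (V3 - V1)" "(dist V1 V2)\<^sup>2 = (V2 - V1) \<bullet> (V2 - V1)"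
    by (simp_all add: dist_norm power2_norm_eq_inner norm_minus_commute[of V1 V2])
  thus ?thesis
    by (simp only: conway_SA_def) (simp add: inner_diff_left inner_diff_right inner_commute)
qed

lemma conway_S_squared:
  "(conway_S V1 V2 V3)\<^sup>2 =
     ((V2 - V1) \<bullet> (V2 - V1)) * ((V3 - V1) \<bullet> (V3 - V1)) - ((V2 - V1) \<bullet> (V3 - V1))\<^sup>2"
proof -
  \<comment> \<open>The triangle is Borel, so its Lebesgue measure agrees with the
    \<open>lborel\<close> measure, for which the determinant formula for the area is
    available.\<close>
  have "compact (convex hull {V1, V2, V3})"
    by (intro compact_convex_hull) auto
  hence "convex hull {V1, V2, V3} \<in> sets borel"
    by (intro borel_closed compact_imp_closed)
  hence "conway_S V1 V2 V3 = 2 * measure lborel (convex hull {V1, V2, V3})"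
    by (simp add: conway_S_def measure_completion)
  thus ?thesis
    unfolding gram_eq_square
    by (simp add: content_triangle power2_abs power_divide)
       (simp add: power2_eq_square algebra_simps)
qed

text \<open>Heron's formula in Conway's notation: it expresses the squared area through side lengths
  and gives the coordinate sum of the orthocenter.\<close>

lemma conway_S_squared_eq:
  fixes V1 V2 V3 :: "real^2"
  defines "a \<equiv> dist V2 V3" and "b \<equiv> dist V3 V1" and "c \<equiv> dist V1 V2"
  shows "(conway_S V1 V2 V3)\<^sup>2 =
     conway_SA b c a * conway_SA c a b + conway_SA c a b * conway_SA a b c
     + conway_SA a b c * conway_SA b c a"
proof -
  have "conway_SA a b c = (V2 - V1) \<bullet> (V3 - V1)" "conway_SA b c a = (V3 - V2) \<bullet> (V1 - V2)"
       "conway_SA c a b = (V1 - V3) \<bullet> (V2 - V3)"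
    unfolding a_def b_def c_def by (rule conway_SA_inner)+
  thus ?thesis
    by (simp only: conway_S_squared inner_vec_def)
       (simp add: sum_2 power2_eq_square algebra_simps)
qed

text \<open>A center function sees only side lengths, so \<open>S^2\<close> is replaced by its
  polynomial in the \<open>conway_SA\<close> terms.\<close>

lemma has_constant_shinagawa_coefficients_exists:
  assumes "(u, v) \<noteq> (0, 0)"
  obtains f where "has_constant_shinagawa_coefficients f u v"
proof
  show "has_constant_shinagawa_coefficients
    (\<lambda>a b c. u * (conway_SA b c a * conway_SA c a b + conway_SA c a b * conway_SA a b c
                  + conway_SA a b c * conway_SA b c a)
             + v * (conway_SA b c a * conway_SA c a b)) u v"
    using assms
    unfolding has_constant_shinagawa_coefficients_def has_shinagawa_coefficients_def
      Let_def conway_S_squared_eq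
    by (simp add: algebra_simps)
qed

section \<open>Orthocenter and circumcenter\<close>

lemma orthocenter_barycentric:
  fixes V1 V2 V3 H :: "real^2"
  defines "a \<equiv> dist V2 V3" and "b \<equiv> dist V3 V1" and "c \<equiv> dist V1 V2"
  assumes "\<not> collinear {V1, V2, V3}" "is_orthocenter H V1 V2 V3"
  shows "(conway_SA b c a * conway_SA c a b) *\<^sub>R V1 + (conway_SA c a b * conway_SA a b c) *\<^sub>R V2
     + (conway_SA a b c * conway_SA b c a) *\<^sub>R V3 = (conway_S V1 V2 V3)\<^sup>2 *\<^sub>R H"
    (is "?L = _")
proof -
  define e where "e = V2 - V1"
  define g where "g = V3 - V1"
  define h where "h = H - V1"
  have Vs: "V2 = V1 + e" "V3 = V1 + g" "H = V1 + h" by (simp_all add: e_def g_def h_def)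
  have SA: "conway_SA a b c = e \<bullet> g" "conway_SA b c a = e \<bullet> e - e \<bullet> g"
           "conway_SA c a b = g \<bullet> g - e \<bullet> g"
    unfolding a_def b_def c_def conway_SA_inner
    by (simp_all add: Vs inner_diff_left inner_diff_right inner_commute)
  have S: "(conway_S V1 V2 V3)\<^sup>2 = (e \<bullet> e) * (g \<bullet> g) - (e \<bullet> g)\<^sup>2"
    by (simp add: conway_S_squared e_def g_def)
  \<comment> \<open>With \<open>V1\<close> as origin, these are the altitudes from \<open>V3\<close>
    and \<open>V2\<close>.\<close>
  have h: "h \<bullet> e = e \<bullet> g" "h \<bullet> g = e \<bullet> g"
    using assms(5)
    by (auto simp: is_orthocenter_def altitude_def Vs inner_diff_left inner_diff_right
        inner_add_left inner_add_right inner_commute)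
  \<comment> \<open>The difference of the two sides of the claim; \<open>V1\<close> cancels because
    the three coordinates sum to \<open>S^2\<close>.\<close>
  define W where "W = ((g \<bullet> g - e \<bullet> g) * (e \<bullet> g)) *\<^sub>R e + ((e \<bullet> g) * (e \<bullet> e - e \<bullet> g)) *\<^sub>R g
     - ((e \<bullet> e) * (g \<bullet> g) - (e \<bullet> g)\<^sup>2) *\<^sub>R h"
  have "W \<bullet> e = 0" "W \<bullet> g = 0"
    unfolding W_def inner_diff_left inner_add_left inner_scaleR_left h inner_commute[of g e]
    by algebra+
  moreover have "(e \<bullet> e) * (g \<bullet> g) - (e \<bullet> g)\<^sup>2 \<noteq> 0"
    using assms(4) gram_nonzero_iff[where ?V1.0 = V1 and ?V2.0 = V2 and ?V3.0 = V3] by (simp add: e_def g_def)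
  ultimately have "W = 0" by (rule orthogonal_to_basis_eq_0[rotated])
  moreover have "?L - (conway_S V1 V2 V3)\<^sup>2 *\<^sub>R H = W"
    unfolding SA S W_def by (simp add: Vs algebra_simps power2_eq_square)
  ultimately show ?thesis by simp
qed

text \<open>Sylvester's relation: measured from \<open>Q\<close>, the vertices sum to the
  orthocenter.\<close>

lemma orthocenter_circumcenter:
  fixes V1 V2 V3 H Q :: "real^2"
  assumes "\<not> collinear {V1, V2, V3}" "is_orthocenter H V1 V2 V3" "{V1, V2, V3} \<subseteq> sphere Q r"
  shows "V1 + V2 + V3 = H + 2 *\<^sub>R Q"
proof -
  define p1 where "p1 = V1 - Q"
  define p2 where "p2 = V2 - Q"
  define p3 where "p3 = V3 - Q"
  define h where "h = H - Q"
  have Vs: "V1 = Q + p1" "V2 = Q + p2" "V3 = Q + p3" "H = Q + h"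
    by (simp_all add: p1_def p2_def p3_def h_def)
  have sq: "p1 \<bullet> p1 = r\<^sup>2" "p2 \<bullet> p2 = r\<^sup>2" "p3 \<bullet> p3 = r\<^sup>2"
    using assms(3)
    by (auto simp: p1_def p2_def p3_def dist_norm norm_minus_commute dot_square_norm)
  \<comment> \<open>For the first product, \<open>h - p3\<close> is orthogonal to
    \<open>p2 - p1\<close> by the altitude from \<open>V3\<close>, and so is \<open>p1 + p2\<close>
    because \<open>p1\<close> and \<open>p2\<close> have equal length. The second is
    analogous.\<close>
  have "(h - (p1 + p2 + p3)) \<bullet> (V2 - V1) = 0" "(h - (p1 + p2 + p3)) \<bullet> (V3 - V1) = 0"
    using assms(2) sq
    by (auto simp: is_orthocenter_def altitude_def Vs inner_diff_left inner_diff_right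
        inner_add_left inner_add_right inner_commute)
  hence "h - (p1 + p2 + p3) = 0"
    using gram_nonzero_iff[where ?V1.0 = V1 and ?V2.0 = V2 and ?V3.0 = V3] assms(1) 
    by (intro orthogonal_to_basis_eq_0[where e = "V2 - V1" and g = "V3 - V1"]) auto
  thus ?thesis by (simp add: Vs algebra_simps scaleR_2)
qed

lemma equilateral_if_circumcenter_eq_centroid:
  fixes V1 V2 V3 Q :: "real^2"
  assumes "V1 + V2 + V3 = 3 *\<^sub>R Q" "{V1, V2, V3} \<subseteq> sphere Q r"
  shows "equilateral V1 V2 V3"
proof -
  have sq: "(V1 - Q) \<bullet> (V1 - Q) = r\<^sup>2" "(V2 - Q) \<bullet> (V2 - Q) = r\<^sup>2" "(V3 - Q) \<bullet> (V3 - Q) = r\<^sup>2"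
    using assms(2) by (auto simp: dist_norm norm_minus_commute dot_square_norm)
  have sum: "(V1 - Q) + (V2 - Q) + (V3 - Q) = 0"
    using assms(1) scaleR_left_distrib[of 1 2 Q] by (simp add: algebra_simps scaleR_2)
  \<comment> \<open>The third vector is \<open>-(x + y)\<close>, so its length forces
    \<open>2 * (x \<bullet> y) = - r^2\<close>. Generic names allow cyclic use for all three
    sides.\<close>
  have dist: "(dist X Y)\<^sup>2 = 3 * r\<^sup>2"
    if "(X - Q) \<bullet> (X - Q) = r\<^sup>2" "(Y - Q) \<bullet> (Y - Q) = r\<^sup>2" "(Z - Q) \<bullet> (Z - Q) = r\<^sup>2"
       "(X - Q) + (Y - Q) + (Z - Q) = 0" for X Y Z :: "real^2"
  proof -
    define x y where "x = X - Q" and "y = Y - Q"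
    have "Z - Q = - (x + y)" using that(4) by (simp add: x_def y_def algebra_simps)
    hence "(x + y) \<bullet> (x + y) = r\<^sup>2"
      using that(3) by (simp only: inner_minus_left inner_minus_right minus_minus)
    moreover have "(dist X Y)\<^sup>2 = (x - y) \<bullet> (x - y)"
      by (simp add: dist_norm power2_norm_eq_inner x_def y_def)
    ultimately show ?thesis
      using that(1,2) unfolding x_def[symmetric] y_def[symmetric]
      by (simp add: inner_diff_left inner_diff_right inner_add_left inner_add_right inner_commute)
  qed
  have "(dist V1 V2)\<^sup>2 = 3 * r\<^sup>2" "(dist V2 V3)\<^sup>2 = 3 * r\<^sup>2" "(dist V3 V1)\<^sup>2 = 3 * r\<^sup>2"
    using dist[of V1 V2 V3] dist[of V2 V3 V1] dist[of V3 V1 V2] sq sum by (simp_all add: algebra_simps)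
  hence "(dist V1 V2)\<^sup>2 = (dist V2 V3)\<^sup>2" "(dist V2 V3)\<^sup>2 = (dist V3 V1)\<^sup>2" by simp_all
  thus ?thesis by (simp add: equilateral_def)
qed

lemma orthocenter_neq_circumcenter:
  fixes V1 V2 V3 H Q :: "real^2"
  assumes "\<not> collinear {V1, V2, V3}" "is_orthocenter H V1 V2 V3" "{V1, V2, V3} \<subseteq> sphere Q r"
    and "\<not> equilateral V1 V2 V3"
  shows "H \<noteq> Q"
proof
  assume "H = Q"
  hence "V1 + V2 + V3 = 3 *\<^sub>R Q"
    using orthocenter_circumcenter[OF assms(1-3)] scaleR_left_distrib[of 1 2 Q] by simp
  thus False
    using equilateral_if_circumcenter_eq_centroid assms(3,4) by blast
qed

section \<open>Signed ratios along the Euler line\<close>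

lemma signed_ratio_Finite:
  assumes "H \<noteq> Q"
  shows "signed_ratio (Finite (Q + t *\<^sub>R (H - Q))) H Q =
     (if t = 0 then Infinite_Ratio else Real_Ratio (1 - 1 / t))"
proof (cases "t = 0")
  case False
  \<comment> \<open>An equivalence for every \<open>r\<close> gives both the existence and the
    uniqueness needed for \<open>THE\<close>.\<close>
  have "H - (Q + t *\<^sub>R (H - Q)) = r *\<^sub>R (Q - (Q + t *\<^sub>R (H - Q))) \<longleftrightarrow> r = 1 - 1 / t" for r
  proof -
    have "H - (Q + t *\<^sub>R (H - Q)) = r *\<^sub>R (Q - (Q + t *\<^sub>R (H - Q)))
        \<longleftrightarrow> (1 - t) *\<^sub>R (H - Q) = (- r * t) *\<^sub>R (H - Q)"
      by (simp add: algebra_simps)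
    also have "\<dots> \<longleftrightarrow> 1 - t = - r * t"
      using assms by (simp only: scaleR_cancel_right) auto
    also have "\<dots> \<longleftrightarrow> r = 1 - 1 / t"
      using False by (auto simp: field_simps)
    finally show ?thesis .
  qed
  thus ?thesis using False assms by simp
qed simp

lemma proj_line_cases:
  assumes "P \<in> proj_line Q H"
  obtains (Finite) t where "P = Finite (Q + t *\<^sub>R (H - Q))"
    | (At_Infinity) d where "P = At_Infinity d" "direction_space d = span {H - Q}"
proof -
  have "(\<exists>t. P = Finite (Q + t *\<^sub>R (H - Q))) \<or>
      (\<exists>d. P = At_Infinity d \<and> direction_space d = span {H - Q})"
    using assms by (auto simp: proj_line_def affine_hull_2_alt)
  thus ?thesis using that by blast
qed

text \<open>The value of \<open>1 - 1 / t\<close> at \<open>t = (u + v) / (3 * u + v)\<close>. The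
  infinite case is the circumcenter; for \<open>(u, v)\<close> not \<open>(0, 0)\<close>,
  \<open>3 * u + v = 0\<close> gives ratio 1, the point at infinity.\<close>

definition euler_ratio :: "real \<Rightarrow> real \<Rightarrow> ratio" where
  "euler_ratio u v = (if u + v = 0 then Infinite_Ratio else Real_Ratio (- 2 * u / (u + v)))"

lemma euler_ratio_surj:
  obtains u v where "(u, v) \<noteq> (0, 0)" "\<rho> = euler_ratio u v"
proof (cases \<rho>)
  case (Real_Ratio r)
  \<comment> \<open>Normalizing \<open>u + v = 2\<close> reduces the ratio to
    \<open>- u\<close>.\<close>
  thus ?thesis by (intro that[of "- r" "r + 2"]) (auto simp: euler_ratio_def)
next
  case Infinite_Ratio
  thus ?thesis by (intro that[of 1 "- 1"]) (auto simp: euler_ratio_def)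
qed

text \<open>The core of the argument: on the Euler line, being the center is a condition on the
  ratio alone, with a value independent of the triangle.\<close>

lemma is_center_of_iff_signed_ratio:
  fixes V1 V2 V3 H Q :: "real^2"
  assumes f: "has_constant_shinagawa_coefficients f u v"
    and V: "distinct [V1, V2, V3]" "{V1, V2, V3} \<subseteq> sphere Q r" "\<not> equilateral V1 V2 V3"
    and H: "is_orthocenter H V1 V2 V3"
    and P: "P \<in> proj_line Q H"
  shows "is_center_of f P V1 V2 V3 \<longleftrightarrow> signed_ratio P H Q = euler_ratio u v"
proof -
  have nc: "\<not> collinear {V1, V2, V3}"
    using V(1,2) by (rule not_collinear_sphere)
  have HQ: "H \<noteq> Q"
    using nc H V(2,3) by (rule orthocenter_neq_circumcenter)
  have uv: "(u, v) \<noteq> (0, 0)"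
    using f by (simp add: has_constant_shinagawa_coefficients_def)
  define a b c where "a = dist V2 V3" and "b = dist V3 V1" and "c = dist V1 V2"
  define s where "s = (conway_S V1 V2 V3)\<^sup>2"
  define x y z where "x = f a b c" and "y = f b c a" and "z = f c a b"
  have s: "s \<noteq> 0"
    using gram_nonzero_iff[where ?V1.0 = V1 and ?V2.0 = V2 and ?V3.0 = V3] nc by (simp add: s_def conway_S_squared)
  have xyz: "x = u * s + v * (conway_SA b c a * conway_SA c a b)"
       "y = u * s + v * (conway_SA c a b * conway_SA a b c)"
       "z = u * s + v * (conway_SA a b c * conway_SA b c a)"
    using f nc
    unfolding has_constant_shinagawa_coefficients_def has_shinagawa_coefficients_def Let_def
      x_def y_def z_def s_def a_def b_def c_def by blast+
  have sum: "x + y + z = (3 * u + v) * s"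
    using conway_S_squared_eq[of V1 V2 V3]
    unfolding xyz s_def a_def[symmetric] b_def[symmetric] c_def[symmetric]
    by (simp add: algebra_simps)
  have "x *\<^sub>R V1 + y *\<^sub>R V2 + z *\<^sub>R V3 = (u * s) *\<^sub>R (V1 + V2 + V3) + v *\<^sub>R (s *\<^sub>R H)"
    unfolding s_def orthocenter_barycentric[OF nc H, symmetric]
    unfolding xyz s_def a_def b_def c_def by (simp add: algebra_simps)
  \<comment> \<open>Sylvester's relation turns the vertex sum into \<open>H + 2 *\<^sub>R Q\<close>;
    splitting off the coordinate sum times \<open>Q\<close> leaves a multiple of
    \<open>H - Q\<close>.\<close>
  also have "\<dots> = s *\<^sub>R ((u + v) *\<^sub>R (H - Q) + (3 * u + v) *\<^sub>R Q)"
    unfolding orthocenter_circumcenter[OF nc H V(2)] by (simp add: algebra_simps)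
       (simp add: scaleR_left_distrib[symmetric] flip: mult_2)
  finally have comb:
    "x *\<^sub>R V1 + y *\<^sub>R V2 + z *\<^sub>R V3 = s *\<^sub>R ((u + v) *\<^sub>R (H - Q) + (3 * u + v) *\<^sub>R Q)" .
  have center: "is_center_of f P V1 V2 V3 \<longleftrightarrow> has_barycentric P V1 V2 V3 x y z"
    by (simp add: is_center_of_def Let_def x_def y_def z_def a_def b_def c_def)
  from P show ?thesis
  proof (cases rule: proj_line_cases)
    case (Finite t)
    have "has_barycentric P V1 V2 V3 x y z \<longleftrightarrow> 3 * u + v \<noteq> 0 \<and> t * (3 * u + v) = u + v"
    proof (cases "3 * u + v = 0")
      case False
      have "(1 / (x + y + z)) *\<^sub>R (x *\<^sub>R V1 + y *\<^sub>R V2 + z *\<^sub>R V3)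
          = (1 / (3 * u + v)) *\<^sub>R ((u + v) *\<^sub>R (H - Q) + (3 * u + v) *\<^sub>R Q)"
        using s by (simp only: sum comb scaleR_scaleR) simp
      also have "\<dots> = Q + ((u + v) / (3 * u + v)) *\<^sub>R (H - Q)"
        using False by (simp only: scaleR_add_right scaleR_scaleR) simp
      finally show ?thesis
        using False s HQ by (simp add: Finite sum) (auto simp: field_simps)
    qed (simp add: Finite sum)
    also have "\<dots> \<longleftrightarrow> signed_ratio P H Q = euler_ratio u v"
    proof -
      have "1 - 1 / t = - 2 * u / (u + v) \<longleftrightarrow> t * (3 * u + v) = u + v" if "t \<noteq> 0" "u + v \<noteq> 0"
        using that by (simp add: field_simps)
      \<comment> \<open>The two linear forms vanish together only at \<open>(0, 0)\<close>.\<close>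
      moreover have "3 * u + v \<noteq> 0" if "u + v = 0"
        using uv that by auto
      ultimately show ?thesis
        unfolding Finite signed_ratio_Finite[OF HQ] euler_ratio_def
        by (cases "t = 0"; cases "u + v = 0") auto
    qed
    finally show ?thesis using center by simp
  next
    case (At_Infinity d)
    \<comment> \<open>Only the coordinate sum matters: once it vanishes, the combination of the
      vertices is a nonzero multiple of \<open>H - Q\<close>, so the direction is that of the Euler
      line.\<close>
    have "has_barycentric P V1 V2 V3 x y z \<longleftrightarrow> 3 * u + v = 0"
    proof (cases "3 * u + v = 0")
      case True
      hence "u + v \<noteq> 0" using uv by auto
      have k: "x *\<^sub>R V1 + y *\<^sub>R V2 + z *\<^sub>R V3 = (s * (u + v)) *\<^sub>R (H - Q)"
        using True by (simp add: comb)
      have "(x, y, z) \<noteq> (0, 0, 0)"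
        using k s HQ \<open>u + v \<noteq> 0\<close> by auto
      moreover have "span {(s * (u + v)) *\<^sub>R (H - Q)} = span {H - Q}"
        using s \<open>u + v \<noteq> 0\<close> span_image_scale[of "{H - Q}" "\<lambda>_. s * (u + v)"] by simp
      ultimately show ?thesis
        using True k by (simp add: At_Infinity sum)
    qed (use s in \<open>simp add: At_Infinity sum\<close>)
    also have "\<dots> \<longleftrightarrow> signed_ratio P H Q = euler_ratio u v"
      using uv by (auto simp: At_Infinity euler_ratio_def field_simps)
    finally show ?thesis using center by simp
  qed
qed

theorem proposition3p4:
  fixes A B C D Q HA HB HC HD :: "real^2" and r :: real
    and PA PB PC PD :: proj_point
  assumes "distinct [A, B, C, D]"
    and "{A, B, C, D} \<subseteq> sphere Q r"
    and "\<not> equilateral A B C" and "\<not> equilateral A B D"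
    and "\<not> equilateral A C D" and "\<not> equilateral B C D"
    and "is_orthocenter HA B C D" and "is_orthocenter HB A C D"
    and "is_orthocenter HC A B D" and "is_orthocenter HD A B C"
    and "PA \<in> proj_line Q HA" and "PB \<in> proj_line Q HB"
    and "PC \<in> proj_line Q HC" and "PD \<in> proj_line Q HD"
  shows "(signed_ratio PA HA Q = signed_ratio PB HB Q \<and>
          signed_ratio PB HB Q = signed_ratio PC HC Q \<and>
          signed_ratio PC HC Q = signed_ratio PD HD Q) \<longleftrightarrow>
         (\<exists>u v. (u, v) \<noteq> (0, 0) \<and>
           (\<exists>f. has_constant_shinagawa_coefficients f u v \<and>
             is_center_of f PA B C D \<and> is_center_of f PB A C D \<and>
             is_center_of f PC A B D \<and> is_center_of f PD A B C))"
    (is "?ratios \<longleftrightarrow> ?centers")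
proof -
  have center: "is_center_of f PA B C D \<longleftrightarrow> signed_ratio PA HA Q = euler_ratio u v"
      "is_center_of f PB A C D \<longleftrightarrow> signed_ratio PB HB Q = euler_ratio u v"
      "is_center_of f PC A B D \<longleftrightarrow> signed_ratio PC HC Q = euler_ratio u v"
      "is_center_of f PD A B C \<longleftrightarrow> signed_ratio PD HD Q = euler_ratio u v"
    if "has_constant_shinagawa_coefficients f u v" for f u v
    by (rule is_center_of_iff_signed_ratio[OF that, where r = r]; insert assms; simp)+
  show ?thesis
  proof
    assume ratios: ?ratios
    \<comment> \<open>The common ratio, finite or infinite, determines suitable constants by
      surjectivity.\<close>
    obtain u v where uv: "(u, v) \<noteq> (0, 0)" "signed_ratio PA HA Q = euler_ratio u v"
      by (rule euler_ratio_surj)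
    obtain f where "has_constant_shinagawa_coefficients f u v"
      using uv(1) by (rule has_constant_shinagawa_coefficients_exists)
    with center uv ratios show ?centers by metis
  next
    assume ?centers
    with center show ?ratios by metis
  qed
qed

end
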